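(* For $p\in[1,\infty)$, let $X^+=(X_1^+,X_2^+)$ be a random vector whose distribution is the positive $L_p$-norm spherical copula in dimension $2$. Then the correlation coefficient of $X_1^+$ and $X_2^+$ is $$\rho_p=\frac{4\,\Gamma(2/p)^2}{\Gamma(1/p)\,\Gamma(3/p)}-3.$$ Moreover, $\lim_{p\to1}\rho_p=-1$, $\lim_{p\to\infty}\rho_p=0$, and the function $p\mapsto\rho_p$ is increasing.
   Context: For $p\in[1,\infty)$ and $x\in\mathbb{R}^n$ put $\|x\|_p=(\sum_{i=1}^n|x_i|^p)^{1/p}$. If a random vector $Z$ in $\mathbb{R}^n$ has a density of the form $g(\|x\|_p)$, then $\|Z\|_p$ and $Z/\|Z\|_p$ are independent and the law of $Z/\|Z\|_p$ does not depend on $g$ (one may take, for instance, $Z$ uniformly distributed on the unit ball $\{\|x\|_p<1\}$); this law is called the $L_p$-uniform distribution on the sphere, and $U_n$ denotes a random vector with this law. Let $U_n^+$ be the vector of componentwise absolute values of $U_n$. A random vector has an $L_p$-norm spherical distribution on $\mathbb{R}_+^n=[0,\infty)^n$ if it has the same law as $R\cdot U_n^+$, with $R\ge0$ a real random variable independent of $U_n^+$. A copula is a probability distribution on $[0,1]^n$ all of whose univariate marginals are uniform on $(0,1)$. A copula is called a positive $L_p$-norm spherical copula if it is an $L_p$-norm spherical distribution on $\mathbb{R}_+^n$. In dimension $n=2$ there is exactly one such copula for every $p\in[1,\infty)$. *)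

theory Defs
  imports "HOL-Probability.Probability"
begin

definition Lp_norm :: "real \<Rightarrow> real ^ 'n \<Rightarrow> real" where
  "Lp_norm p x = (\<Sum>i\<in>UNIV. \<bar>x $ i\<bar> powr p) powr (1 / p)"

text \<open>
  The law of \<open>Z / \<parallel>Z\<parallel>\<^sub>p\<close> for \<open>Z\<close> uniform on the open \<open>L\<^sub>p\<close> unit ball. This is not the normalised
  surface measure of the \<open>L\<^sub>p\<close> sphere, except for special \<open>p\<close>. The value \<open>0\<close> assigned
  to \<open>Z = 0\<close> is irrelevant, since \<open>Z = 0\<close> has probability zero.
\<close>

definition Lp_uniform :: "real \<Rightarrow> (real ^ 'n) measure" where
  "Lp_uniform p =
     distr (uniform_measure lborel {x. Lp_norm p x < 1}) borel (\<lambda>x. x /\<^sub>R Lp_norm p x)"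

definition Lp_uniform_pos :: "real \<Rightarrow> (real ^ 'n) measure" where
  "Lp_uniform_pos p = distr (Lp_uniform p) borel (\<lambda>x. \<chi> i. \<bar>x $ i\<bar>)"

text \<open>
  \<open>N\<close> is the law of the radius \<open>R\<close>. Independence of \<open>R\<close> and \<open>U\<^sup>+\<close> means that their joint
  law is the product measure (the library's \<^const>\<open>prob_space.indep_var\<close> requires both variables
  to take values in the same type).
\<close>

definition Lp_spherical_pos :: "real \<Rightarrow> (real ^ 'n) measure \<Rightarrow> bool" where
  "Lp_spherical_pos p D \<longleftrightarrow>
     (\<exists>N :: real measure. prob_space N \<and> sets N = sets borel \<and> (AE r in N. 0 \<le> r) \<and>
        D = distr (N \<Otimes>\<^sub>M Lp_uniform_pos p) borel (\<lambda>(r, u). r *\<^sub>R u))"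

definition copula :: "(real ^ 'n) measure \<Rightarrow> bool" where
  "copula D \<longleftrightarrow>
     prob_space D \<and> sets D = sets borel \<and> (AE x in D. \<forall>i. x $ i \<in> {0..1}) \<and>
     (\<forall>i. distr D borel (\<lambda>x. x $ i) = uniform_measure lborel {0<..<1})"

definition Lp_spherical_pos_copula :: "real \<Rightarrow> (real ^ 'n) measure \<Rightarrow> bool" where
  "Lp_spherical_pos_copula p D \<longleftrightarrow> copula D \<and> Lp_spherical_pos p D"

definition (in prob_space) correlation :: "('a \<Rightarrow> real) \<Rightarrow> ('a \<Rightarrow> real) \<Rightarrow> real" where
  "correlation X Y =
     expectation (\<lambda>\<omega>. (X \<omega> - expectation X) * (Y \<omega> - expectation Y)) /
       sqrt (variance X * variance Y)"

end

theory Submission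
  imports Defs
begin

text \<open>
  Uniform marginals force \<open>E X\<^sub>i = 1/2\<close> and \<open>E X\<^sub>i\<^sup>2 = 1/3\<close>. Writing \<open>X = R U\<^sup>+\<close>, the radius
  contributes the same factor \<open>E R\<^sup>2\<close> to \<open>E X\<^sub>1 X\<^sub>2\<close> and to \<open>E X\<^sub>1\<^sup>2\<close>, so the correlation is
  \<open>4 E U\<^sub>1 U\<^sub>2 / E U\<^sub>1\<^sup>2 - 3\<close> for \<open>U = U\<^sup>+\<close>. By integration in \<open>L\<^sub>p\<close>-polar coordinates this last
  ratio is unchanged when \<open>U\<close> is replaced by a vector with density proportional to
  \<open>exp (- \<parallel>x\<parallel>\<^sub>p\<^sup>p)\<close>, whose coordinates are independent; the moments are then Gamma integrals.

  With \<open>t = 1/p\<close>, Euler's product for Gamma gives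
  \<open>\<Gamma>(2t)\<^sup>2 / (\<Gamma>(t) \<Gamma>(3t)) = \<Prod>\<^sub>i (1 - (t / (2t + i))\<^sup>2)\<close>, in which every factor decreases in \<open>t\<close>.
\<close>

section \<open>Monotonicity of the Gamma ratio through Euler's product\<close>

text \<open>In the approximants \<open>Gamma_series\<close> the factorials and the powers of
  \<open>n\<close> cancel, because \<open>2 * 2t = t + 3t\<close>. The remaining Pochhammer symbols
  combine factor by factor through \<open>(t + i) (3t + i) = (2t + i)^2 - t^2\<close>.\<close>

lemma Gamma_ratio_product:
  fixes t :: real
  assumes "t > 0"
  shows "(\<lambda>n. \<Prod>i=0..n. 1 - (t / (2 * t + real i))\<^sup>2) \<longlonglongrightarrow>
    (Gamma (2 * t))\<^sup>2 / (Gamma t * Gamma (3 * t))"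
proof -
  have "(\<lambda>n. (Gamma_series (2 * t) n)\<^sup>2 / (Gamma_series t n * Gamma_series (3 * t) n))
      \<longlonglongrightarrow> (Gamma (2 * t))\<^sup>2 / (Gamma t * Gamma (3 * t))"
    using assms by (intro tendsto_intros) (simp add: Gamma_real_pos less_imp_neq[symmetric])
  moreover have "(Gamma_series (2 * t) n)\<^sup>2 / (Gamma_series t n * Gamma_series (3 * t) n) =
      (\<Prod>i=0..n. 1 - (t / (2 * t + real i))\<^sup>2)" for n
  proof -
    have e: "(exp (2 * t * ln (real n)))\<^sup>2 = exp (t * ln (real n)) * exp (3 * t * ln (real n))"
      by (simp flip: exp_add exp_double)
    have "pochhammer t (n + 1) > 0" "pochhammer (2 * t) (n + 1) > 0" "pochhammer (3 * t) (n + 1) > 0"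
      using assms by (auto intro!: pochhammer_pos)
    then have "(Gamma_series (2 * t) n)\<^sup>2 / (Gamma_series t n * Gamma_series (3 * t) n) =
        pochhammer t (n + 1) * pochhammer (3 * t) (n + 1) / (pochhammer (2 * t) (n + 1))\<^sup>2"
      using e by (simp add: Gamma_series_def power_divide power_mult_distrib power2_eq_square
          divide_simps del: exp_gt_zero)
    also have "\<dots> = (\<Prod>i=0..n. (t + i) * (3 * t + i) / (2 * t + i)\<^sup>2)"
      unfolding Suc_eq_plus1[symmetric] pochhammer_Suc_prod
      by (simp add: prod_dividef prod.distrib prod_power_distrib)
    also have "\<dots> = (\<Prod>i=0..n. 1 - (t / (2 * t + real i))\<^sup>2)"
    proof (rule prod.cong)
      fix i
      have "2 * t + real i \<noteq> 0" using assms by (smt (verit) of_nat_0_le_iff)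
      then show "(t + i) * (3 * t + i) / (2 * t + i)\<^sup>2 = 1 - (t / (2 * t + real i))\<^sup>2"
        by (simp add: power_divide divide_simps) (simp add: algebra_simps power2_eq_square)
    qed simp
    finally show ?thesis .
  qed
  ultimately show ?thesis by simp
qed

text \<open>Each factor of the product is weakly decreasing in \<open>t\<close>, but a limit of
  products keeps only weak inequalities. One strictly decreasing factor is therefore split off
  before the limit is taken.\<close>

lemma Gamma_ratio_strict_antimono:
  fixes s t :: real
  assumes "0 < s" "s < t"
  shows "(Gamma (2 * t))\<^sup>2 / (Gamma t * Gamma (3 * t)) < (Gamma (2 * s))\<^sup>2 / (Gamma s * Gamma (3 * s))"
proof -
  define f where "f = (\<lambda>i (t::real). 1 - (t / (2 * t + real i))\<^sup>2)"
  define L where "L = (\<lambda>t::real. (Gamma (2 * t))\<^sup>2 / (Gamma t * Gamma (3 * t)))"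
  have lim: "(\<lambda>n. \<Prod>i=0..n. f i t) \<longlonglongrightarrow> L t" if "t > 0" for t
    using Gamma_ratio_product[OF that] by (simp add: f_def L_def)
  have f_nonneg: "0 \<le> f i t" if "t > 0" for t i
  proof -
    have "t / (2 * t + real i) \<le> 1" using that by (simp add: field_simps)
    moreover have "0 \<le> t / (2 * t + real i)" using that by simp
    ultimately show ?thesis by (simp add: f_def power_le_one)
  qed
  have f_anti: "f i t \<le> f i s" for i
  proof -
    have "s / (2 * s + real i) \<le> t / (2 * t + real i)"
      using assms by (simp add: frac_le_eq divide_simps mult_right_mono) (simp add: algebra_simps mult_right_mono)
    then show ?thesis using assms by (simp add: f_def power_mono)
  qed
  \<comment> \<open>The factor for \<open>i = 0\<close> is the constant 3/4, so \<open>i = 1\<close>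
    is the first one that is strictly decreasing.\<close>
  have "s / (2 * s + 1) < t / (2 * t + 1)"
    using assms by (simp add: divide_simps algebra_simps)
  then have f1: "f 1 t < f 1 s"
    using assms by (simp add: f_def power_strict_mono)
  \<comment> \<open>Cross-multiplying by the factors at index 1 leaves a comparison of the remaining
    products. It survives the limit, and the strict gap between \<open>f 1 t\<close> and
    \<open>f 1 s\<close> is used only afterwards.\<close>
  have "(\<Prod>i=0..n. f i t) * f 1 s \<le> (\<Prod>i=0..n. f i s) * f 1 t" if "1 \<le> n" for n
  proof -
    have "1 \<in> {0..n}" using that by simp
    then have split: "(\<Prod>i=0..n. f i u) = f 1 u * (\<Prod>i\<in>{0..n}-{1}. f i u)" for u
      by (subst prod.remove) auto
    have "(\<Prod>i\<in>{0..n}-{1}. f i t) \<le> (\<Prod>i\<in>{0..n}-{1}. f i s)"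
      using assms by (intro prod_mono) (auto intro: f_nonneg f_anti)
    then have "f 1 t * f 1 s * (\<Prod>i\<in>{0..n}-{1}. f i t) \<le> f 1 t * f 1 s * (\<Prod>i\<in>{0..n}-{1}. f i s)"
      using assms by (intro mult_left_mono mult_nonneg_nonneg f_nonneg) auto
    then show ?thesis by (simp add: split mult_ac)
  qed
  then have le: "L t * f 1 s \<le> L s * f 1 t"
    using assms
    by (intro tendsto_le[OF _ tendsto_mult_right[OF lim] tendsto_mult_right[OF lim]])
       (auto intro: eventually_sequentiallyI[of 1])
  have "L s > 0"
    using assms unfolding L_def
    by (intro divide_pos_pos zero_less_power mult_pos_pos Gamma_real_pos) auto
  then have "L s * f 1 t < L s * f 1 s" using f1 by simp
  with le have "L t * f 1 s < L s * f 1 s" by simp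
  moreover have "f 1 s > 0" using f1 f_nonneg[of t 1] assms by simp
  ultimately have "L t < L s" by (simp only: mult_less_cancel_right_pos)
  then show ?thesis by (simp add: L_def)
qed

lemma rho_strict_mono:
  "strict_mono_on {1..} (\<lambda>p::real. 4 * (Gamma (2 / p))\<^sup>2 / (Gamma (1 / p) * Gamma (3 / p)) - 3)"
proof (rule strict_mono_onI)
  fix p q :: real assume "p \<in> {1..}" "q \<in> {1..}" "p < q"
  then show "4 * (Gamma (2 / p))\<^sup>2 / (Gamma (1 / p) * Gamma (3 / p)) - 3 <
      4 * (Gamma (2 / q))\<^sup>2 / (Gamma (1 / q) * Gamma (3 / q)) - 3"
    using Gamma_ratio_strict_antimono[of "1 / q" "1 / p"] by (simp add: frac_less2)
qed

section \<open>Limits of the correlation at 1 and at infinity\<close>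

lemma rho_tendsto_1:
  "((\<lambda>p::real. 4 * (Gamma (2 / p))\<^sup>2 / (Gamma (1 / p) * Gamma (3 / p)) - 3) \<longlongrightarrow> -1) (at_right 1)"
proof -
  have "Gamma (3::real) = 2" "Gamma (2::real) = 1"
    using Gamma_fact[of 2, where 'a=real] Gamma_fact[of 1, where 'a=real] by (simp_all add: fact_numeral)
  moreover have "((\<lambda>p::real. 4 * (Gamma (2 / p))\<^sup>2 / (Gamma (1 / p) * Gamma (3 / p)) - 3) \<longlongrightarrow>
      4 * (Gamma (2 / 1))\<^sup>2 / (Gamma (1 / 1) * Gamma (3 / 1)) - 3) (at_right 1)"
    using calculation by (intro tendsto_intros) auto
  ultimately show ?thesis by simp
qed

text \<open>All the Gamma arguments tend to the pole at 0. The recurrence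
  \<open>Gamma (z + 1) = z * Gamma z\<close> moves them to 1, where Gamma is continuous. The factors
  \<open>c / p\<close> turn the constant 4 into \<open>4 * (1 * 3) / 2^2 = 3\<close>, which cancels
  the subtracted 3.\<close>

lemma rho_tendsto_infinity:
  "((\<lambda>p::real. 4 * (Gamma (2 / p))\<^sup>2 / (Gamma (1 / p) * Gamma (3 / p)) - 3) \<longlongrightarrow> 0) at_top"
proof -
  have lim: "((\<lambda>p::real. Gamma (c / p + 1)) \<longlongrightarrow> Gamma (0 + 1)) at_top" for c :: real
    by (intro tendsto_intros tendsto_divide_0[OF tendsto_const] filterlim_at_top_imp_at_infinity filterlim_ident) simp
  have "((\<lambda>p::real. 3 * (Gamma (2 / p + 1))\<^sup>2 / (Gamma (1 / p + 1) * Gamma (3 / p + 1)) - 3) \<longlongrightarrow>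
      3 * (Gamma (0 + 1))\<^sup>2 / (Gamma (0 + 1) * Gamma (0 + 1)) - 3) at_top"
    by (intro tendsto_intros lim) auto
  then have "((\<lambda>p::real. 3 * (Gamma (2 / p + 1))\<^sup>2 / (Gamma (1 / p + 1) * Gamma (3 / p + 1)) - 3) \<longlongrightarrow> 0) at_top"
    by simp
  moreover have "\<forall>\<^sub>F p::real in at_top. 3 * (Gamma (2 / p + 1))\<^sup>2 / (Gamma (1 / p + 1) * Gamma (3 / p + 1)) - 3
      = 4 * (Gamma (2 / p))\<^sup>2 / (Gamma (1 / p) * Gamma (3 / p)) - 3"
    using eventually_gt_at_top[of 0]
  proof eventually_elim
    case (elim p)
    then have *: "Gamma (c / p + 1) = c / p * Gamma (c / p)" if "c > 0" for c
      using that by (intro Gamma_plus1) (metis divide_pos_pos nonpos_Ints_nonpos not_le)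
    show ?case using elim by (simp add: * power_divide power_mult_distrib power2_eq_square)
  qed
  ultimately show ?thesis by (rule Lim_transform_eventually)
qed

section \<open>Integration in generalised polar coordinates\<close>

lemma nn_integral_lborel_scaleR:
  fixes f :: "'a::euclidean_space \<Rightarrow> ennreal"
  assumes [measurable]: "f \<in> borel_measurable borel" and "c > 0"
  shows "(\<integral>\<^sup>+x. f x \<partial>lborel) = ennreal (c ^ DIM('a)) * (\<integral>\<^sup>+x. f (c *\<^sub>R x) \<partial>lborel)"
  using assms(2)
  by (subst lborel_affine[of c 0]) (simp_all add: nn_integral_density nn_integral_distr nn_integral_cmult)

text \<open>The antiderivative is \<open>- (r powr - d)\<close>. Writing \<open>s powr - d\<close>
  as an integral over \<open>r > s\<close> is what introduces the radius as a new variable in the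
  polar formula.\<close>

lemma nn_integral_powr_tail:
  fixes s :: real
  assumes "s > 0" "0 < d"
  shows "(\<integral>\<^sup>+r. ennreal (real d * r powr (- real d - 1)) * indicator {s<..} r \<partial>lborel)
    = ennreal (s powr - real d)"
proof -
  have "(\<integral>\<^sup>+r. ennreal (real d * r powr (- real d - 1)) * indicator {s<..} r \<partial>lborel)
      = (\<integral>\<^sup>+r. ennreal (real d * r powr (- real d - 1)) * indicator {s..} r \<partial>lborel)"
    using AE_lborel_singleton[of s] by (intro nn_integral_cong_AE) (auto simp: indicator_def)
  also have "\<dots> = ennreal (0 - - (s powr - real d))"
  proof (rule nn_integral_FTC_atLeast)
    show "((\<lambda>r. - (r powr - real d)) \<longlongrightarrow> 0) at_top"
      using tendsto_minus[OF tendsto_neg_powr[OF _ filterlim_ident, of "- real d"]] assms by simp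
  qed (use assms in \<open>auto intro!: derivative_eq_intros\<close>)
  finally show ?thesis by simp
qed

text \<open>The direction-dependent part \<open>F\<close> is integrated over the ball
  \<open>q < 1\<close>, so no surface measure appears. The radial weight
  \<open>d * u ^ (d - 1)\<close> has mass one on the interval from 0 to 1, as the choice of
  \<open>G\<close> as the indicator of \<open>u < 1\<close> requires.\<close>

lemma nn_integral_polar:
  fixes q :: "'a::euclidean_space \<Rightarrow> real" and F :: "'a \<Rightarrow> ennreal" and G :: "real \<Rightarrow> ennreal"
  assumes [measurable]: "q \<in> borel_measurable borel" "F \<in> borel_measurable borel" "G \<in> borel_measurable borel"
    and q_pos: "\<And>x. x \<noteq> 0 \<Longrightarrow> q x > 0"
    and q_scale: "\<And>c x. c > 0 \<Longrightarrow> q (c *\<^sub>R x) = c * q x"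
    and F_scale: "\<And>c x. c > 0 \<Longrightarrow> F (c *\<^sub>R x) = F x"
  shows "(\<integral>\<^sup>+x. F x * G (q x) \<partial>lborel) =
    (\<integral>\<^sup>+x. F x * indicator {x. q x < 1} x \<partial>lborel) *
    (\<integral>\<^sup>+u. ennreal (DIM('a) * u ^ (DIM('a) - 1)) * G u * indicator {0<..} u \<partial>lborel)"
proof -
  let ?d = "DIM('a)"
  define k where "k = (\<lambda>s. ennreal (s ^ ?d) * G s)"
  have [measurable]: "k \<in> borel_measurable borel" unfolding k_def by measurable
  have ae: "AE x in (lborel :: 'a measure). x \<noteq> 0" by (rule AE_lborel_singleton)
  \<comment> \<open>Insert \<open>1 = q(x)\<^sup>d \<integral>\<^bsub>r > q(x)\<^esub> d r powr (-d-1) dr\<close>, swap the integrals and rescale \<open>x = r y\<close>, then \<open>u = r q(y)\<close>.\<close>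
  have "(\<integral>\<^sup>+x. F x * G (q x) \<partial>lborel) =
      (\<integral>\<^sup>+x. (\<integral>\<^sup>+r. F x * k (q x) * (ennreal (?d * r powr (- real ?d - 1)) * indicator {q x<..} r) \<partial>lborel) \<partial>lborel)"
  proof (rule nn_integral_cong_AE, use ae in eventually_elim)
    case (elim x)
    then have "q x > 0" by (rule q_pos)
    then have "ennreal (q x ^ ?d) * ennreal (q x powr - real ?d) = 1"
      by (simp add: powr_realpow powr_minus flip: ennreal_mult)
    then have "k (q x) * ennreal (q x powr - real ?d) = G (q x)"
      by (simp add: k_def mult_ac)
    then show ?case
      using \<open>q x > 0\<close> by (simp add: nn_integral_cmult nn_integral_powr_tail mult.assoc)
  qed
  also have "\<dots> = (\<integral>\<^sup>+r. (\<integral>\<^sup>+x. F x * k (q x) * (ennreal (?d * r powr (- real ?d - 1)) * indicator {q x<..} r) \<partial>lborel) \<partial>lborel)"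
    by (subst lborel_pair.Fubini') (auto simp: indicator_def greaterThan_def)
  also have "\<dots> = (\<integral>\<^sup>+r. (\<integral>\<^sup>+y. F y * indicator {x. q x < 1} y * (ennreal (?d / r) * k (r * q y) * indicator {0<..} r) \<partial>lborel) \<partial>lborel)"
  proof (rule nn_integral_cong)
    fix r :: real
    show "(\<integral>\<^sup>+x. F x * k (q x) * (ennreal (?d * r powr (- real ?d - 1)) * indicator {q x<..} r) \<partial>lborel)
      = (\<integral>\<^sup>+y. F y * indicator {x. q x < 1} y * (ennreal (?d / r) * k (r * q y) * indicator {0<..} r) \<partial>lborel)"
    proof (cases "r > 0")
      case False
      have "(\<integral>\<^sup>+x. F x * k (q x) * (ennreal (?d * r powr (- real ?d - 1)) * indicator {q x<..} r) \<partial>lborel) = 0"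
        using ae False by (intro nn_integral_zero' , elim eventually_mono) (auto simp: indicator_def dest: q_pos)
      then show ?thesis using False by simp
    next
      case True
      \<comment> \<open>The Jacobian of \<open>x = r y\<close> leaves the scale-invariant weight
        \<open>d / r\<close>; hence the later substitution \<open>u = r * q y\<close> gives a radial
        integral that does not depend on \<open>y\<close>.\<close>
      have c: "r ^ ?d * (?d * r powr (- real ?d - 1)) = ?d / r"
        using True by (simp add: powr_diff powr_minus powr_realpow field_simps)
      have "(\<integral>\<^sup>+x. F x * k (q x) * (ennreal (?d * r powr (- real ?d - 1)) * indicator {q x<..} r) \<partial>lborel)
        = ennreal (r ^ ?d) * (\<integral>\<^sup>+y. F (r *\<^sub>R y) * k (q (r *\<^sub>R y)) * (ennreal (?d * r powr (- real ?d - 1)) * indicator {q (r *\<^sub>R y)<..} r) \<partial>lborel)"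
        using True by (intro nn_integral_lborel_scaleR) (auto simp: indicator_def greaterThan_def)
      also have "\<dots> = (\<integral>\<^sup>+y. ennreal (r ^ ?d) * (F (r *\<^sub>R y) * k (q (r *\<^sub>R y)) * (ennreal (?d * r powr (- real ?d - 1)) * indicator {q (r *\<^sub>R y)<..} r)) \<partial>lborel)"
        by (rule nn_integral_cmult[symmetric]) (auto simp: indicator_def greaterThan_def)
      also have "\<dots> = (\<integral>\<^sup>+y. F y * indicator {x. q x < 1} y * (ennreal (?d / r) * k (r * q y) * indicator {0<..} r) \<partial>lborel)"
      proof (rule nn_integral_cong)
        fix y
        show "ennreal (r ^ ?d) * (F (r *\<^sub>R y) * k (q (r *\<^sub>R y)) * (ennreal (?d * r powr (- real ?d - 1)) * indicator {q (r *\<^sub>R y)<..} r))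
          = F y * indicator {x. q x < 1} y * (ennreal (?d / r) * k (r * q y) * indicator {0<..} r)"
          using True unfolding c[symmetric]
          by (simp add: q_scale F_scale indicator_def ennreal_mult mult_ac)
      qed
      finally show ?thesis .
    qed
  qed
  also have "\<dots> = (\<integral>\<^sup>+y. (\<integral>\<^sup>+r. F y * indicator {x. q x < 1} y * (ennreal (?d / r) * k (r * q y) * indicator {0<..} r) \<partial>lborel) \<partial>lborel)"
    by (subst lborel_pair.Fubini') auto
  also have "\<dots> = (\<integral>\<^sup>+y. F y * indicator {x. q x < 1} y *
     (\<integral>\<^sup>+u. ennreal (DIM('a) * u ^ (DIM('a) - 1)) * G u * indicator {0<..} u \<partial>lborel) \<partial>lborel)"
  proof (rule nn_integral_cong_AE, use ae in eventually_elim)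
    case (elim y)
    then have q: "q y > 0" by (rule q_pos)
    have "(\<integral>\<^sup>+r. F y * indicator {x. q x < 1} y * (ennreal (?d / r) * k (r * q y) * indicator {0<..} r) \<partial>lborel)
      = F y * indicator {x. q x < 1} y * (\<integral>\<^sup>+r. ennreal (?d / r) * k (r * q y) * indicator {0<..} r \<partial>lborel)"
      by (rule nn_integral_cmult) auto
    also have "(\<integral>\<^sup>+r. ennreal (?d / r) * k (r * q y) * indicator {0<..} r \<partial>lborel)
      = (\<integral>\<^sup>+r. ennreal (q y) * (ennreal (?d * (q y * r) ^ (?d - 1)) * G (q y * r) * indicator {0<..} (q y * r)) \<partial>lborel)"
    proof (rule nn_integral_cong)
      fix r
      show "ennreal (?d / r) * k (r * q y) * indicator {0<..} r =
         ennreal (q y) * (ennreal (?d * (q y * r) ^ (?d - 1)) * G (q y * r) * indicator {0<..} (q y * r))"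
      proof (cases "r > 0")
        case True
        \<comment> \<open>The truncated subtraction in \<open>d - 1\<close> is harmless because the
          dimension is positive.\<close>
        have "?d / r * (r * q y) ^ ?d = q y * (?d * (q y * r) ^ (?d - 1))"
          using True DIM_positive[where 'a='a] by (cases ?d) (auto simp: field_simps)
        then have "ennreal (?d / r) * ennreal ((r * q y) ^ ?d) = ennreal (q y) * ennreal (?d * (q y * r) ^ (?d - 1))"
          using True q by (simp flip: ennreal_mult)
        then show ?thesis using True q by (simp add: k_def mult.commute[of r] mult.assoc[symmetric])
      next
        case False
        then have "\<not> 0 < q y * r" using q by (simp add: zero_less_mult_iff)
        then show ?thesis using False by simp
      qed
    qed
    also have "\<dots> = ennreal \<bar>q y\<bar> * (\<integral>\<^sup>+r. ennreal (?d * (0 + q y * r) ^ (?d - 1)) * G (0 + q y * r) * indicator {0<..} (0 + q y * r) \<partial>lborel)"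
      using q by (simp add: nn_integral_cmult)
    also have "\<dots> = (\<integral>\<^sup>+u. ennreal (?d * u ^ (?d - 1)) * G u * indicator {0<..} u \<partial>lborel)"
      using q by (intro nn_integral_real_affine[symmetric]) auto
    finally show ?case .
  qed
  also have "\<dots> = (\<integral>\<^sup>+x. F x * indicator {x. q x < 1} x \<partial>lborel) *
    (\<integral>\<^sup>+u. ennreal (?d * u ^ (?d - 1)) * G u * indicator {0<..} u \<partial>lborel)"
    by (rule nn_integral_multc) auto
  finally show ?thesis .
qed

section \<open>One-dimensional Gamma integrals\<close>

text \<open>Substitute \<open>t = x powr p\<close> in Euler's integral for
  \<open>Gamma ((a + 1) / p)\<close>; the condition on \<open>a\<close> makes this argument
  positive.\<close>

lemma nn_integral_powr_exp_powr:
  fixes a p :: real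
  assumes "a > -1" "p > 0"
  shows "(\<integral>\<^sup>+x. ennreal (x powr a * exp (- (x powr p))) * indicator {0<..} x \<partial>lborel)
    = ennreal (Gamma ((a + 1) / p) / p)"
proof -
  let ?f = "\<lambda>t::real. t powr ((a + 1) / p - 1) / exp t"
  let ?S = "{0::real<..}"
  have s: "(a + 1) / p > 0" using assms by simp
  \<comment> \<open>Euler's integral runs over the closed half-line. The null endpoint 0 is removed
    so that \<open>x powr p\<close> is a differentiable bijection of the domain onto itself.\<close>
  have hi: "(?f has_integral Gamma ((a + 1) / p)) ?S"
  proof -
    have "((\<lambda>t. if t \<in> ?S then ?f t else 0) has_integral Gamma ((a + 1) / p)) {0..}"
      by (rule has_integral_spike [of "{0}", rotated 2, OF Gamma_integral_real[OF s]]) auto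
    then show ?thesis by (subst (asm) has_integral_restrict) auto
  qed
  have ab: "?f absolutely_integrable_on ?S"
    using hi by (intro nonnegative_absolutely_integrable_1) (auto simp: has_integral_integrable)
  have im: "(\<lambda>x. x powr p) ` ?S = ?S"
  proof (intro equalityI subsetI)
    fix y :: real assume "y \<in> ?S"
    then have "y = (y powr (1 / p)) powr p" using assms by (simp add: powr_powr)
    then show "y \<in> (\<lambda>x. x powr p) ` ?S" using \<open>y \<in> ?S\<close> by (intro image_eqI[of _ _ "y powr (1 / p)"]) auto
  qed auto
  have "inj_on (\<lambda>x. x powr p) ?S"
  proof (rule inj_onI)
    fix x y :: real assume "x \<in> ?S" "y \<in> ?S" "x powr p = y powr p"
    then have "(x powr p) powr (1 / p) = (y powr p) powr (1 / p)" by simp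
    with \<open>x \<in> ?S\<close> \<open>y \<in> ?S\<close> assms show "x = y" by (simp add: powr_powr)
  qed
  then have "(\<lambda>x. \<bar>p * x powr (p - 1)\<bar> * ?f (x powr p)) absolutely_integrable_on ?S \<and>
      integral ?S (\<lambda>x. \<bar>p * x powr (p - 1)\<bar> * ?f (x powr p)) = Gamma ((a + 1) / p)"
    using ab hi
    by (subst has_absolute_integral_change_of_variables_1')
       (auto simp: im intro!: derivative_eq_intros)
  then have "((\<lambda>x. \<bar>p * x powr (p - 1)\<bar> * ?f (x powr p)) has_integral Gamma ((a + 1) / p)) ?S"
    by (simp add: has_integral_iff set_lebesgue_integral_eq_integral)
  then have "((\<lambda>x. (1 / p) * (\<bar>p * x powr (p - 1)\<bar> * ?f (x powr p))) has_integral (1 / p) * Gamma ((a + 1) / p)) ?S"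
    by (rule has_integral_mult_right)
  \<comment> \<open>The exponents add up as
    \<open>(p - 1) + p * ((a + 1) / p - 1) = a\<close>.\<close>
  moreover have "(1 / p) * (\<bar>p * x powr (p - 1)\<bar> * ?f (x powr p)) = x powr a * exp (- (x powr p))" if "x \<in> ?S" for x
  proof -
    have "x powr (p - 1) * x powr (p * ((a + 1) / p - 1)) = x powr a"
      using that assms by (simp flip: powr_add) (simp add: field_simps)
    then show ?thesis using that assms by (simp add: powr_powr exp_minus field_simps)
  qed
  ultimately have "((\<lambda>x. x powr a * exp (- (x powr p))) has_integral (1 / p) * Gamma ((a + 1) / p)) ?S"
    by (subst (asm) has_integral_cong) auto
  then have "(\<integral>\<^sup>+x. ennreal (indicator ?S x * (x powr a * exp (- (x powr p)))) \<partial>lborel) = ennreal ((1 / p) * Gamma ((a + 1) / p))"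
    by (rule nn_integral_has_integral_lebesgue[rotated]) auto
  moreover have "(\<integral>\<^sup>+x. ennreal (x powr a * exp (- (x powr p))) * indicator ?S x \<partial>lborel)
     = (\<integral>\<^sup>+x. ennreal (indicator ?S x * (x powr a * exp (- (x powr p)))) \<partial>lborel)"
    by (intro nn_integral_cong) (auto simp: indicator_def)
  ultimately show ?thesis by simp
qed

lemma nn_integral_even:
  fixes f :: "real \<Rightarrow> ennreal"
  assumes [measurable]: "f \<in> borel_measurable borel" and even: "\<And>x. f (- x) = f x"
  shows "(\<integral>\<^sup>+x. f x \<partial>lborel) = 2 * (\<integral>\<^sup>+x. f x * indicator {0<..} x \<partial>lborel)"
proof -
  have "(\<integral>\<^sup>+x. f x \<partial>lborel) = (\<integral>\<^sup>+x. f x * indicator {0<..} x + f x * indicator {..<0} x \<partial>lborel)"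
    using AE_lborel_singleton[of "0::real"] by (intro nn_integral_cong_AE) (auto simp: indicator_def)
  also have "\<dots> = (\<integral>\<^sup>+x. f x * indicator {0<..} x \<partial>lborel) + (\<integral>\<^sup>+x. f x * indicator {..<0} x \<partial>lborel)"
    by (rule nn_integral_add) auto
  also have "(\<integral>\<^sup>+x. f x * indicator {..<0} x \<partial>lborel) = (\<integral>\<^sup>+x. f x * indicator {0<..} x \<partial>lborel)"
    by (subst nn_integral_real_affine[of _ "-1" 0]) (auto simp: even indicator_def intro!: nn_integral_cong)
  finally show ?thesis by (simp add: mult_2)
qed

lemma nn_integral_abs_powr_exp_powr:
  fixes a p :: real
  assumes "a > -1" "p > 0"
  shows "(\<integral>\<^sup>+x. ennreal (\<bar>x\<bar> powr a * exp (- (\<bar>x\<bar> powr p))) \<partial>lborel)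
    = ennreal (2 * Gamma ((a + 1) / p) / p)"
proof -
  have "(\<integral>\<^sup>+x. ennreal (\<bar>x\<bar> powr a * exp (- (\<bar>x\<bar> powr p))) \<partial>lborel)
    = 2 * (\<integral>\<^sup>+x. ennreal (\<bar>x\<bar> powr a * exp (- (\<bar>x\<bar> powr p))) * indicator {0<..} x \<partial>lborel)"
    by (rule nn_integral_even) auto
  also have "(\<integral>\<^sup>+x. ennreal (\<bar>x\<bar> powr a * exp (- (\<bar>x\<bar> powr p))) * indicator {0<..} x \<partial>lborel)
    = (\<integral>\<^sup>+x. ennreal (x powr a * exp (- (x powr p))) * indicator {0<..} x \<partial>lborel)"
    by (intro nn_integral_cong) (auto simp: indicator_def)
  also have "\<dots> = ennreal (Gamma ((a + 1) / p) / p)"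
    by (rule nn_integral_powr_exp_powr[OF assms])
  also have "2 * ennreal (Gamma ((a + 1) / p) / p) = ennreal (2 * Gamma ((a + 1) / p) / p)"
    using ennreal_mult'[of 2 "Gamma ((a + 1) / p) / p"] by simp
  finally show ?thesis .
qed

section \<open>The L_p norm and the density with independent coordinates\<close>

lemma Lp_norm_measurable [measurable]: "Lp_norm p \<in> borel_measurable borel"
  unfolding Lp_norm_def by measurable

lemma Lp_norm_pos:
  assumes "x \<noteq> 0" "p > 0"
  shows "Lp_norm p x > 0"
proof -
  obtain i where "x $ i \<noteq> 0" using assms by (auto simp: vec_eq_iff)
  then have "(\<Sum>i\<in>UNIV. \<bar>x $ i\<bar> powr p) > 0"
    by (intro sum_pos2[of _ i]) auto
  then show ?thesis by (simp add: Lp_norm_def)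
qed

lemma Lp_norm_scaleR:
  assumes "c > 0" "p > 0"
  shows "Lp_norm p (c *\<^sub>R x) = c * Lp_norm p x"
  using assms
  by (simp add: Lp_norm_def abs_mult powr_mult sum_nonneg powr_powr flip: sum_distrib_left)

text \<open>The p-th power of the norm is a sum over the coordinates, so its exponential factors and
  the integral is a product of two one-dimensional Gamma integrals.\<close>

lemma nn_integral_exp_Lp_norm:
  fixes p a b :: real
  assumes "p > 0" "a > -1" "b > -1"
  shows "(\<integral>\<^sup>+x. ennreal (\<bar>x $ 1\<bar> powr a * \<bar>x $ 2\<bar> powr b * exp (- (Lp_norm p (x :: real ^ 2) powr p))) \<partial>lborel)
    = ennreal (4 * (Gamma ((a + 1) / p) * Gamma ((b + 1) / p)) / p\<^sup>2)"
proof -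
  define e where "e = (\<lambda>c y::real. ennreal (\<bar>y\<bar> powr c * exp (- (\<bar>y\<bar> powr p))))"
  have [measurable]: "e c \<in> borel_measurable borel" for c unfolding e_def by measurable
  \<comment> \<open>The product rule for \<open>lborel\<close> indexes its factors by
    \<open>Basis\<close>, so the two exponents are assigned to the two unit vectors.\<close>
  define h where "h = (\<lambda>v::real^2. if v = axis 1 1 then e a else e b)"
  have B: "Basis = {axis 1 1, axis 2 1 :: real ^ 2}"
    by (auto simp: Basis_vec_def UNIV_2)
  have ne: "axis 1 1 \<noteq> (axis 2 1 :: real ^ 2)" by (simp add: axis_eq_axis)
  have "ennreal (\<bar>x $ 1\<bar> powr a * \<bar>x $ 2\<bar> powr b * exp (- (Lp_norm p x powr p)))
      = (\<Prod>v\<in>Basis. h v (x \<bullet> v))" for x :: "real ^ 2"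
  proof -
    have "Lp_norm p x powr p = \<bar>x $ 1\<bar> powr p + \<bar>x $ 2\<bar> powr p"
      using assms by (simp add: Lp_norm_def powr_powr sum_2)
    then show ?thesis
      using ne by (simp add: B h_def e_def inner_axis exp_add exp_diff exp_minus field_simps flip: ennreal_mult)
  qed
  then have "(\<integral>\<^sup>+x. ennreal (\<bar>x $ 1\<bar> powr a * \<bar>x $ 2\<bar> powr b * exp (- (Lp_norm p (x :: real ^ 2) powr p))) \<partial>lborel)
     = (\<Prod>v\<in>Basis. (\<integral>\<^sup>+y. h v y \<partial>lborel))"
    by (simp only:) (rule nn_integral_lborel_prod, auto simp: h_def)
  also have "\<dots> = ennreal (2 * Gamma ((a + 1) / p) / p) * ennreal (2 * Gamma ((b + 1) / p) / p)"
    using ne assms nn_integral_abs_powr_exp_powr[of a p] nn_integral_abs_powr_exp_powr[of b p]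
    by (simp add: B h_def e_def)
  also have "\<dots> = ennreal (4 * (Gamma ((a + 1) / p) * Gamma ((b + 1) / p)) / p\<^sup>2)"
    using assms Gamma_real_pos[of "(a + 1) / p"] Gamma_real_pos[of "(b + 1) / p"]
    by (subst ennreal_mult[symmetric]) (auto simp: power2_eq_square)
  finally show ?thesis .
qed

section \<open>Degree-two moments of the L_p-uniform law and of spherical laws\<close>

lemma Lp_uniform_pos_sets [simp, measurable_cong]: "sets (Lp_uniform_pos p) = sets borel"
  by (simp add: Lp_uniform_pos_def)

lemma abs_vec_measurable [measurable]: "(\<lambda>x::real^'n. \<chi> i. \<bar>x $ i\<bar>) \<in> borel_measurable borel"
  by (auto intro!: borel_measurable_continuous_onI continuous_intros)

text \<open>
  The total mass is \<open>m / m\<close> with \<open>m\<close> the volume of the unit ball; this is finite even without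
  knowing that \<open>0 < m < \<infinity>\<close>, as \<open>0 / 0\<close> and \<open>\<infinity> / \<infinity>\<close> are \<open>0\<close> in the extended nonnegative reals.
\<close>

lemma finite_measure_Lp_uniform_pos: "finite_measure (Lp_uniform_pos p :: (real ^ 'n) measure)"
proof
  let ?B = "{x :: real ^ 'n. Lp_norm p x < 1}"
  have "emeasure lborel ?B / emeasure lborel ?B \<noteq> \<infinity>"
    by (cases "emeasure lborel ?B = 0 \<or> emeasure lborel ?B = \<infinity>")
       (auto simp: ennreal_divide_self top.not_eq_extremum)
  then show "emeasure (Lp_uniform_pos p :: (real ^ 'n) measure) (space (Lp_uniform_pos p)) \<noteq> \<infinity>"
    by (simp add: Lp_uniform_pos_def Lp_uniform_def emeasure_distr)
qed

text \<open>The ratio is cross-multiplied so that no finiteness or positivity of the integrals is needed.\<close>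

lemma Lp_uniform_pos_moment_ratio:
  fixes f g :: "real ^ 2 \<Rightarrow> real"
  assumes "p > 0"
    and [measurable]: "f \<in> borel_measurable borel" "g \<in> borel_measurable borel"
    and nonneg: "\<And>x. 0 \<le> f x" "\<And>x. 0 \<le> g x"
    and even: "\<And>x. f (\<chi> i. \<bar>x $ i\<bar>) = f x" "\<And>x. g (\<chi> i. \<bar>x $ i\<bar>) = g x"
    and hom: "\<And>c x. f (c *\<^sub>R x) = c\<^sup>2 * f x" "\<And>c x. g (c *\<^sub>R x) = c\<^sup>2 * g x"
  shows "(\<integral>\<^sup>+u. f u \<partial>Lp_uniform_pos p) * (\<integral>\<^sup>+x. g x * exp (- (Lp_norm p x powr p)) \<partial>lborel)
    = (\<integral>\<^sup>+u. g u \<partial>Lp_uniform_pos p) * (\<integral>\<^sup>+x. f x * exp (- (Lp_norm p x powr p)) \<partial>lborel)"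
proof -
  let ?q = "Lp_norm p :: real ^ 2 \<Rightarrow> real"
  define B where "B = {x. ?q x < 1}"
  have [measurable]: "B \<in> sets borel" unfolding B_def by measurable
  \<comment> \<open>For \<open>h\<close> homogeneous of degree two,
    \<open>h x / (Lp_norm p x)^2\<close> depends only on the direction. Its integral
    \<open>K h\<close> over the ball determines both the moment of the uniform law and the integral
    against the exponential, with factors \<open>1 / emeasure lborel B\<close> and \<open>C\<close>
    that are the same for every \<open>h\<close>.\<close>
  define C where "C = (\<integral>\<^sup>+u. ennreal (DIM(real^2) * u ^ (DIM(real^2) - 1)) *
      ennreal (u\<^sup>2 * exp (- (u powr p))) * indicator {0<..} u \<partial>lborel)"
  define K where "K = (\<lambda>h :: real ^ 2 \<Rightarrow> real. \<integral>\<^sup>+x. ennreal (h x / (?q x)\<^sup>2) * indicator B x \<partial>lborel)"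
  have *: "(\<integral>\<^sup>+u. h u \<partial>Lp_uniform_pos p) = K h / emeasure lborel B \<and>
      (\<integral>\<^sup>+x. h x * exp (- (?q x powr p)) \<partial>lborel) = K h * C"
    if [measurable]: "h \<in> borel_measurable borel" and nn: "\<And>x. 0 \<le> h x"
      and even: "\<And>x. h (\<chi> i. \<bar>x $ i\<bar>) = h x" and hom: "\<And>c x. h (c *\<^sub>R x) = c\<^sup>2 * h x" for h
  proof
    have "(\<integral>\<^sup>+u. h u \<partial>Lp_uniform_pos p) = (\<integral>\<^sup>+x. ennreal (h (x /\<^sub>R ?q x)) * indicator B x \<partial>lborel) / emeasure lborel B"
      by (simp add: Lp_uniform_pos_def Lp_uniform_def nn_integral_distr nn_integral_uniform_measure even flip: B_def)
    then show "(\<integral>\<^sup>+u. h u \<partial>Lp_uniform_pos p) = K h / emeasure lborel B"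
      by (simp add: K_def hom power_inverse field_simps)
    have "(\<integral>\<^sup>+x. h x * exp (- (?q x powr p)) \<partial>lborel)
       = (\<integral>\<^sup>+x. ennreal (h x / (?q x)\<^sup>2) * ennreal ((?q x)\<^sup>2 * exp (- (?q x powr p))) \<partial>lborel)"
    proof (rule nn_integral_cong_AE, use AE_lborel_singleton[of "0 :: real ^ 2"] in eventually_elim)
      case (elim x)
      then have "?q x > 0" using Lp_norm_pos assms(1) by blast
      then show ?case using nn[of x] by (simp flip: ennreal_mult)
    qed
    also have "\<dots> = K h * C"
      unfolding K_def C_def B_def
    proof (rule nn_integral_polar)
      fix c :: real and x :: "real ^ 2" assume "c > 0"
      then show "?q (c *\<^sub>R x) = c * ?q x" "ennreal (h (c *\<^sub>R x) / (?q (c *\<^sub>R x))\<^sup>2) = ennreal (h x / (?q x)\<^sup>2)"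
        using assms(1) by (simp_all add: Lp_norm_scaleR hom power_mult_distrib)
    qed (use assms(1) Lp_norm_pos in auto)
    finally show "(\<integral>\<^sup>+x. h x * exp (- (?q x powr p)) \<partial>lborel) = K h * C" .
  qed
  show ?thesis
    using *[of f] *[of g] nonneg even hom by (simp add: divide_ennreal_def mult_ac)
qed

text \<open>Homogeneity takes \<open>r^2\<close> out of the inner integral of the product law, so
  the radius contributes one factor common to all such \<open>f\<close>. Finiteness of the uniform
  law supplies the sigma-finiteness for the iterated integral.\<close>

lemma nn_integral_Lp_spherical_pos:
  fixes f :: "real ^ 'n \<Rightarrow> real"
  assumes N: "prob_space N" "sets N = sets borel"
    and D: "D = distr (N \<Otimes>\<^sub>M Lp_uniform_pos p) borel (\<lambda>(r, u). r *\<^sub>R u)"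
    and [measurable]: "f \<in> borel_measurable borel"
    and nonneg: "\<And>x. 0 \<le> f x" and hom: "\<And>c x. f (c *\<^sub>R x) = c\<^sup>2 * f x"
  shows "(\<integral>\<^sup>+x. f x \<partial>D) = (\<integral>\<^sup>+r. ennreal (r\<^sup>2) \<partial>N) * (\<integral>\<^sup>+u. f u \<partial>Lp_uniform_pos p)"
proof -
  note N(2) [measurable_cong]
  interpret U: finite_measure "Lp_uniform_pos p :: (real ^ 'n) measure" by (rule finite_measure_Lp_uniform_pos)
  have "(\<integral>\<^sup>+x. f x \<partial>D) = (\<integral>\<^sup>+z. ennreal (f (fst z *\<^sub>R snd z)) \<partial>(N \<Otimes>\<^sub>M Lp_uniform_pos p))"
    unfolding D by (subst nn_integral_distr) (auto simp: case_prod_beta)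
  also have "\<dots> = (\<integral>\<^sup>+r. \<integral>\<^sup>+u. ennreal (f (r *\<^sub>R u)) \<partial>Lp_uniform_pos p \<partial>N)"
    by (subst U.nn_integral_fst[symmetric]) auto
  also have "\<dots> = (\<integral>\<^sup>+r. ennreal (r\<^sup>2) * (\<integral>\<^sup>+u. f u \<partial>Lp_uniform_pos p) \<partial>N)"
    using nonneg by (simp add: hom ennreal_mult nn_integral_cmult)
  also have "\<dots> = (\<integral>\<^sup>+r. ennreal (r\<^sup>2) \<partial>N) * (\<integral>\<^sup>+u. f u \<partial>Lp_uniform_pos p)"
    by (rule nn_integral_multc) auto
  finally show ?thesis .
qed

section \<open>The correlation of the copula\<close>

text \<open>The open and the closed unit interval differ by a null set. The closed form is the one
  in which the mean and the variance of uniform variables are stated.\<close>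

lemma distributed_uniform_unit:
  assumes "distr M borel X = uniform_measure lborel {0<..<1}" "X \<in> borel_measurable M"
  shows "distributed M lborel X (\<lambda>x. indicator {0..1::real} x / measure lborel {0..1::real})"
proof -
  have "uniform_measure lborel {0<..<1::real} = density lborel (\<lambda>x. ennreal (indicator {0..1} x / measure lborel {0..1::real}))"
    unfolding uniform_measure_def
    using AE_lborel_singleton[of "0::real"] AE_lborel_singleton[of "1::real"]
    by (intro density_cong) (auto simp: indicator_def elim!: eventually_elim2)
  moreover have "distr M lborel X = distr M borel X"
    by (rule distr_cong) auto
  ultimately show ?thesis using assms by (simp add: distributed_def)
qed

lemma correlation_Lp_spherical_pos_copula:
  fixes X :: "'a \<Rightarrow> real ^ 2"
  assumes p: "p > 0" and M: "prob_space M" and X [measurable]: "X \<in> borel_measurable M"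
    and cop: "Lp_spherical_pos_copula p (distr M borel X)"
  shows "prob_space.correlation M (\<lambda>\<omega>. X \<omega> $ 1) (\<lambda>\<omega>. X \<omega> $ 2) =
    4 * (Gamma (2 / p))\<^sup>2 / (Gamma (1 / p) * Gamma (3 / p)) - 3"
proof -
  interpret prob_space M by (rule M)
  let ?D = "distr M borel X"
  obtain N where N: "prob_space N" "sets N = sets borel"
    and D: "?D = distr (N \<Otimes>\<^sub>M Lp_uniform_pos p) borel (\<lambda>(r, u). r *\<^sub>R u)"
    using cop by (auto simp: Lp_spherical_pos_copula_def Lp_spherical_pos_def)
  have Xi [measurable]: "(\<lambda>\<omega>. X \<omega> $ i) \<in> borel_measurable M" for i
    by (rule measurable_compose[OF X]) (intro borel_measurable_continuous_onI continuous_intros)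
  have "AE x in ?D. \<forall>i. x $ i \<in> {0..1}"
    using cop by (simp add: Lp_spherical_pos_copula_def copula_def)
  then have X01: "AE \<omega> in M. X \<omega> $ i \<in> {0..1}" for i
    by (subst (asm) AE_distr_iff) auto
  have unif: "distributed M lborel (\<lambda>\<omega>. X \<omega> $ i) (\<lambda>x. indicator {0..1} x / measure lborel {0..1::real})" for i
  proof (rule distributed_uniform_unit)
    have "distr ?D borel (\<lambda>x. x $ i) = distr M borel (\<lambda>\<omega>. X \<omega> $ i)"
      by (subst distr_distr) (auto simp: comp_def)
    then show "distr M borel (\<lambda>\<omega>. X \<omega> $ i) = uniform_measure lborel {0<..<1}"
      using cop by (simp add: Lp_spherical_pos_copula_def copula_def)
  qed (rule Xi)
  have mean: "expectation (\<lambda>\<omega>. X \<omega> $ i) = 1 / 2" for i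
    using uniform_distributed_expectation[OF unif[of i]] by simp
  have var: "variance (\<lambda>\<omega>. X \<omega> $ i) = 1 / 12" for i
    using uniform_distributed_variance[OF unif[of i]] by simp
  have int: "integrable M (\<lambda>\<omega>. X \<omega> $ i)" for i
    using X01[of i] by (intro integrable_const_bound[of _ 1]) auto
  have int2: "integrable M (\<lambda>\<omega>. X \<omega> $ i * X \<omega> $ j)" for i j
    using X01[of i] X01[of j]
    by (intro integrable_const_bound[of _ 1]) (auto elim!: eventually_elim2 simp: abs_mult mult_le_one)
  \<comment> \<open>Variance plus squared mean: \<open>1/12 + 1/4 = 1/3\<close>.\<close>
  have sq: "expectation (\<lambda>\<omega>. (X \<omega> $ 1)\<^sup>2) = 1 / 3"
    using variance_eq[OF int[of 1]] int2[of 1 1] var[of 1] mean[of 1]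
    by (simp add: power2_eq_square)
  define R where "R = (\<integral>\<^sup>+r. ennreal (r\<^sup>2) \<partial>N)"
  \<comment> \<open>The absolute value makes \<open>f\<close> nonnegative and invariant under sign
    changes of the coordinates; almost surely it does not alter the product of the coordinates of
    \<open>X\<close>.\<close>
  define f where "f = (\<lambda>x::real^2. \<bar>x $ 1 * x $ 2\<bar>)"
  define g where "g = (\<lambda>x::real^2. (x $ 1)\<^sup>2)"
  have [measurable]: "f \<in> borel_measurable borel" "g \<in> borel_measurable borel"
    unfolding f_def g_def by measurable
  have nonneg: "0 \<le> f x" "0 \<le> g x" for x by (simp_all add: f_def g_def)
  have hom: "f (c *\<^sub>R x) = c\<^sup>2 * f x" "g (c *\<^sub>R x) = c\<^sup>2 * g x" for c x
    by (simp_all add: f_def g_def abs_mult power_mult_distrib power2_eq_square)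
  have even: "f (\<chi> i. \<bar>x $ i\<bar>) = f x" "g (\<chi> i. \<bar>x $ i\<bar>) = g x" for x
    by (simp_all add: f_def g_def abs_mult)
  have f_eq: "ennreal (expectation (\<lambda>\<omega>. X \<omega> $ 1 * X \<omega> $ 2)) = R * (\<integral>\<^sup>+u. f u \<partial>Lp_uniform_pos p)"
  proof -
    have "(\<integral>\<^sup>+x. f x \<partial>?D) = (\<integral>\<^sup>+\<omega>. ennreal (X \<omega> $ 1 * X \<omega> $ 2) \<partial>M)"
      using X01[of 1] X01[of 2]
      by (subst nn_integral_distr) (auto simp: f_def intro!: nn_integral_cong_AE elim!: eventually_elim2)
    also have "\<dots> = ennreal (expectation (\<lambda>\<omega>. X \<omega> $ 1 * X \<omega> $ 2))"
      using X01[of 1] X01[of 2] by (intro nn_integral_eq_integral int2) (auto elim!: eventually_elim2)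
    finally show ?thesis
      using nn_integral_Lp_spherical_pos[OF N D, of f] nonneg hom by (simp add: R_def)
  qed
  have g_eq: "ennreal (1 / 3) = R * (\<integral>\<^sup>+u. g u \<partial>Lp_uniform_pos p)"
  proof -
    have "(\<integral>\<^sup>+x. g x \<partial>?D) = (\<integral>\<^sup>+\<omega>. ennreal ((X \<omega> $ 1)\<^sup>2) \<partial>M)"
      by (subst nn_integral_distr) (auto simp: g_def)
    also have "\<dots> = ennreal (1 / 3)"
      using int2[of 1 1] sq by (subst nn_integral_eq_integral) (auto simp: power2_eq_square)
    finally show ?thesis
      using nn_integral_Lp_spherical_pos[OF N D, of g] nonneg hom by (simp add: R_def)
  qed
  \<comment> \<open>The exponents 1, 1 give the Gamma argument \<open>2 / p\<close> twice; for
    \<open>g\<close> the exponents 2, 0 give \<open>3 / p\<close> and \<open>1 / p\<close>.\<close>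
  have f_exp: "(\<integral>\<^sup>+x. f x * exp (- (Lp_norm p x powr p)) \<partial>lborel) = ennreal (4 * (Gamma (2 / p))\<^sup>2 / p\<^sup>2)"
    using nn_integral_exp_Lp_norm[OF p, where a = 1 and b = 1] by (simp add: f_def abs_mult power2_eq_square)
  have g_exp: "(\<integral>\<^sup>+x. g x * exp (- (Lp_norm p x powr p)) \<partial>lborel) = ennreal (4 * (Gamma (1 / p) * Gamma (3 / p)) / p\<^sup>2)"
  proof -
    \<comment> \<open>Since \<open>0 powr 0 = 0\<close>, the factor
      \<open>\<bar>x $ 2\<bar> powr 0\<close> equals 1 only off the line \<open>x $ 2 = 0\<close>,
      which must be shown to be a null set.\<close>
    have "{x :: real ^ 2. x $ 2 = 0} \<in> null_sets (completion lborel)"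
      using negligible_standard_hyperplane_cart[of 2] by (simp add: negligible_iff_null_sets)
    then have "{x :: real ^ 2. x $ 2 = 0} \<in> null_sets lborel"
      by (subst (asm) null_sets_completion_iff) auto
    then have "AE x :: real ^ 2 in lborel. x $ 2 \<noteq> 0"
      by (auto dest!: AE_not_in)
    then have "(\<integral>\<^sup>+x. g x * exp (- (Lp_norm p x powr p)) \<partial>lborel) =
        (\<integral>\<^sup>+x. ennreal (\<bar>x $ 1\<bar> powr 2 * \<bar>x $ 2\<bar> powr 0 * exp (- (Lp_norm p (x :: real ^ 2) powr p))) \<partial>lborel)"
      by (intro nn_integral_cong_AE) (auto simp: g_def elim!: eventually_mono)
    also have "\<dots> = ennreal (4 * (Gamma (1 / p) * Gamma (3 / p)) / p\<^sup>2)"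
      using nn_integral_exp_Lp_norm[OF p, where a = 2 and b = 0] by (simp add: mult.commute)
    finally show ?thesis .
  qed
  have "Gamma (1 / p) > 0" "Gamma (3 / p) > 0"
    using p by (auto intro!: Gamma_real_pos)
  then have Gpos: "Gamma (1 / p) * Gamma (3 / p) > 0" by simp
  \<comment> \<open>Multiplying the cross-multiplied moment identity by \<open>R\<close> turns the
    two uniform moments into \<open>E X_1 X_2\<close> and \<open>1 / 3\<close>, without division by
    extended nonnegative reals.\<close>
  have "ennreal (expectation (\<lambda>\<omega>. X \<omega> $ 1 * X \<omega> $ 2)) * ennreal (4 * (Gamma (1 / p) * Gamma (3 / p)) / p\<^sup>2)
      = ennreal (1 / 3) * ennreal (4 * (Gamma (2 / p))\<^sup>2 / p\<^sup>2)"
    using Lp_uniform_pos_moment_ratio[OF p, of f g] nonneg hom even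
    unfolding f_eq g_eq f_exp g_exp by (simp add: mult.assoc)
  moreover have "expectation (\<lambda>\<omega>. X \<omega> $ 1 * X \<omega> $ 2) \<ge> 0"
    using X01[of 1] X01[of 2] by (intro integral_nonneg_AE) (auto elim!: eventually_elim2)
  ultimately have "expectation (\<lambda>\<omega>. X \<omega> $ 1 * X \<omega> $ 2) * (4 * (Gamma (1 / p) * Gamma (3 / p)) / p\<^sup>2)
      = 1 / 3 * (4 * (Gamma (2 / p))\<^sup>2 / p\<^sup>2)"
    using Gpos by (simp flip: ennreal_mult del: ennreal_eq_1)
  moreover have Gpos': "3 * (Gamma (1 / p) * Gamma (3 / p)) > 0"
    using Gpos by simp
  ultimately have prod: "expectation (\<lambda>\<omega>. X \<omega> $ 1 * X \<omega> $ 2) =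
      (Gamma (2 / p))\<^sup>2 / (3 * (Gamma (1 / p) * Gamma (3 / p)))"
    using p by (subst nonzero_eq_divide_eq[OF less_imp_neq[OF Gpos', symmetric]]) (simp add: field_simps)
  have "expectation (\<lambda>\<omega>. (X \<omega> $ 1 - 1 / 2) * (X \<omega> $ 2 - 1 / 2)) =
      expectation (\<lambda>\<omega>. X \<omega> $ 1 * X \<omega> $ 2 - X \<omega> $ 1 / 2 - X \<omega> $ 2 / 2 + 1 / 4)"
    by (simp add: algebra_simps)
  also have "\<dots> = expectation (\<lambda>\<omega>. X \<omega> $ 1 * X \<omega> $ 2) - 1 / 4"
    using int int2 by (simp add: mean prob_space)
  finally have cov: "expectation (\<lambda>\<omega>. (X \<omega> $ 1 - 1 / 2) * (X \<omega> $ 2 - 1 / 2)) =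
      (Gamma (2 / p))\<^sup>2 / (3 * (Gamma (1 / p) * Gamma (3 / p))) - 1 / 4"
    by (simp only: prod)
  \<comment> \<open>Dividing by the standard deviations multiplies the covariance by 12, which turns
    the denominator factor 3 into the factor 4 and the term \<open>1 / 4\<close> into 3.\<close>
  have "correlation (\<lambda>\<omega>. X \<omega> $ 1) (\<lambda>\<omega>. X \<omega> $ 2) =
      ((Gamma (2 / p))\<^sup>2 / (3 * (Gamma (1 / p) * Gamma (3 / p))) - 1 / 4) / sqrt (1 / 12 * (1 / 12))"
    unfolding correlation_def var by (simp only: mean cov)
  then show ?thesis
    by (simp only: real_sqrt_abs2) (simp add: field_simps)
qed

theorem theorem8:
  shows "let \<rho> = (\<lambda>p::real. 4 * (Gamma (2 / p))\<^sup>2 / (Gamma (1 / p) * Gamma (3 / p)) - 3) in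
    (\<forall>p\<ge>1. \<forall>(M :: 'a measure) (X :: 'a \<Rightarrow> real ^ 2).
       prob_space M \<longrightarrow> X \<in> borel_measurable M \<longrightarrow>
       Lp_spherical_pos_copula p (distr M borel X) \<longrightarrow>
       prob_space.correlation M (\<lambda>\<omega>. X \<omega> $ 1) (\<lambda>\<omega>. X \<omega> $ 2) = \<rho> p) \<and>
    (\<rho> \<longlongrightarrow> -1) (at_right 1) \<and>
    (\<rho> \<longlongrightarrow> 0) at_top \<and>
    strict_mono_on {1..} \<rho>"
  unfolding Let_def
  using rho_tendsto_1 rho_tendsto_infinity rho_strict_mono
  by (auto intro!: correlation_Lp_spherical_pos_copula)

end
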